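(* Let $(\phi_0,\phi_1)\colon(X,S)\to(X',S')$ be a surjective admissible morphism of association schemes, and let $(\lambda_1,\dots,\lambda_m)$, $m=|S'|$, be the vector of the eigenvalues of $O_{(X',S')}$ (counting multiplicities). Then there is a positive integer $k$ such that $(k\lambda_1,\dots,k\lambda_m)$ is a subvector of the vector of the eigenvalues (counting multiplicities) of $O_{(X,S)}$; i.e. the multiset $\{k\lambda_1,\dots,k\lambda_m\}$ is contained, with multiplicities, in the multiset of eigenvalues of $O_{(X,S)}$.
   Context: A coherent configuration $(X,S)$ is a finite set $X$ with a partition $S$ of $X\times X$ such that: if $p\in S$ contains some $(x,x)$ then $p\subseteq\mathrm{id}_X$; for $a,b,c\in S$ the number $\nabla_{ab}^c$ of $z\in X$ with $(x,z)\in a$, $(z,y)\in b$ is the same for all $(x,y)\in c$; and $c\in S$ implies $c^{-1}=\{(y,x):(x,y)\in c\}\in S$. It is an association scheme (scheme) if $\mathrm{id}_X\in S$. The valency $\|a\|$ of $a\in S$ is the number of $y\in X$ with $(x,y)\in a$, for any $x$ for which at least one such $y$ exists (independent of $x$). Put $\dot\nabla_{ab}^c=\sqrt{\frac{\|c\|}{\|a\|\|b\|}}\,\nabla_{ab}^c$. The matrix $O_{(X,S)}=\dot\nabla\circ\dot\nabla^\dagger$ is the real symmetric $S\times S$ matrix with entries $O_a^b=\sum_{p,q\in S}\dot\nabla_{pq}^a\dot\nabla_{pq}^b$. A morphism $(X,S)\to(X',S')$ is a pair of maps $\phi_0\colon X\to X'$, $\phi_1\colon S\to S'$ such that $(x,y)\in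 a$ implies $(\phi_0(x),\phi_0(y))\in\phi_1(a)$. It is admissible if for all $x\in X$, $y'\in X'$, $a\in S$ such that there is some $w\in X$ with $(x,w)\in a$, and such that $(\phi_0(x),y')\in\phi_1(a)$, there exists $y\in X$ with $\phi_0(y)=y'$ and $(x,y)\in a$. (For association schemes the condition that such a $w$ exists is automatic.) Surjective means that $\phi_0$ and $\phi_1$ are surjective. *)

theory Defs
  imports
    Complex_Main
    "HOL-Library.Disjoint_Sets"
    "HOL-Library.Multiset"
    "Jordan_Normal_Form.Char_Poly"
begin

section \<open>Coherent configurations and association schemes\<close>

definition coherent_configuration :: "'a set \<Rightarrow> 'a rel set \<Rightarrow> bool" where
  "coherent_configuration X S \<longleftrightarrow>
     finite X \<and> partition_on (X \<times> X) S \<and>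
     (\<forall>p\<in>S. (\<exists>x. (x, x) \<in> p) \<longrightarrow> p \<subseteq> Id_on X) \<and>
     (\<forall>a\<in>S. \<forall>b\<in>S. \<forall>c\<in>S. \<exists>n. \<forall>(x, y)\<in>c. card {z \<in> X. (x, z) \<in> a \<and> (z, y) \<in> b} = n) \<and>
     (\<forall>c\<in>S. c\<inverse> \<in> S)"

definition association_scheme :: "'a set \<Rightarrow> 'a rel set \<Rightarrow> bool" where
  "association_scheme X S \<longleftrightarrow> coherent_configuration X S \<and> Id_on X \<in> S"

text \<open>The structure constants $\nabla_{ab}^c$:\<close>

definition intersection_number :: "'a set \<Rightarrow> 'a rel \<Rightarrow> 'a rel \<Rightarrow> 'a rel \<Rightarrow> nat" where
  "intersection_number X a b c =
     (THE n. \<forall>(x, y)\<in>c. card {z \<in> X. (x, z) \<in> a \<and> (z, y) \<in> b} = n)"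

definition valency :: "'a set \<Rightarrow> 'a rel \<Rightarrow> nat" where
  "valency X a = (THE n. \<forall>x\<in>Domain a. card {y \<in> X. (x, y) \<in> a} = n)"

text \<open>The two descriptions above denote the intended numbers.\<close>

lemma intersection_number_eq:
  assumes "coherent_configuration X S" "a \<in> S" "b \<in> S" "c \<in> S" "(x, y) \<in> c"
  shows "intersection_number X a b c = card {z \<in> X. (x, z) \<in> a \<and> (z, y) \<in> b}"
proof -
  obtain n where n: "\<forall>(x, y)\<in>c. card {z \<in> X. (x, z) \<in> a \<and> (z, y) \<in> b} = n"
    using assms unfolding coherent_configuration_def by meson
  show ?thesis
    unfolding intersection_number_def
  proof (rule the_equality)
    show "\<forall>(x', y')\<in>c. card {z \<in> X. (x', z) \<in> a \<and> (z, y') \<in> b} = card {z \<in> X. (x, z) \<in> a \<and> (z, y) \<in> b}"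
      using n bspec[OF n assms(5)] by simp
  next
    fix m assume "\<forall>(x', y')\<in>c. card {z \<in> X. (x', z) \<in> a \<and> (z, y') \<in> b} = m"
    from bspec[OF this assms(5)] show "m = card {z \<in> X. (x, z) \<in> a \<and> (z, y) \<in> b}" by simp
  qed
qed

lemma valency_eq:
  assumes cc: "coherent_configuration X S" and a: "a \<in> S" and x: "x \<in> Domain a"
  shows "valency X a = card {y \<in> X. (x, y) \<in> a}"
proof -
  note cc' = cc[unfolded coherent_configuration_def]
  from cc' have fin: "finite X" and part: "partition_on (X \<times> X) S" by simp_all
  from cc' a have conv: "a\<inverse> \<in> S" by simp
  have diag: "p \<subseteq> Id_on X" if "p \<in> S" "(x, x) \<in> p" for p x
    using cc'[THEN conjunct2, THEN conjunct2, THEN conjunct1] that by blast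
  have sub: "a \<subseteq> X \<times> X"
    using part a by (auto simp: partition_on_def)
  obtain y where xy: "(x, y) \<in> a" using x by blast
  with sub part obtain e where e: "e \<in> S" "(x, x) \<in> e"
    by (auto simp: partition_on_def)
  note eid = diag[OF e]
  have deg: "intersection_number X a (a\<inverse>) e = card {z \<in> X. (w, z) \<in> a}" if "(w, w) \<in> e" for w
    using intersection_number_eq[OF cc a conv e(1) that] by simp
  have "card {y \<in> X. (w, y) \<in> a} = card {y \<in> X. (x, y) \<in> a}" if w: "w \<in> Domain a" for w
  proof -
    obtain v where wv: "(w, v) \<in> a" using w by blast
    have "x \<in> {z \<in> X. (x, z) \<in> e \<and> (z, y) \<in> a}" using e xy sub by auto
    hence "card {z \<in> X. (x, z) \<in> e \<and> (z, y) \<in> a} \<noteq> 0"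
      using fin card_gt_0_iff[of "{z \<in> X. (x, z) \<in> e \<and> (z, y) \<in> a}"] by auto
    hence "card {z \<in> X. (w, z) \<in> e \<and> (z, v) \<in> a} \<noteq> 0"
      using intersection_number_eq[OF cc e(1) a a xy] intersection_number_eq[OF cc e(1) a a wv] by simp
    hence "{z \<in> X. (w, z) \<in> e \<and> (z, v) \<in> a} \<noteq> {}"
      by (metis card.empty)
    then obtain z where "(w, z) \<in> e" by blast
    with eid have "(w, w) \<in> e" by auto
    from deg[OF this] deg[OF e(2)] show ?thesis by simp
  qed
  hence all: "\<forall>w\<in>Domain a. card {y \<in> X. (w, y) \<in> a} = card {y \<in> X. (x, y) \<in> a}"
    by (rule ballI)
  show ?thesis
    unfolding valency_def
  proof (rule the_equality)
    show "\<forall>w\<in>Domain a. card {y \<in> X. (w, y) \<in> a} = card {y \<in> X. (x, y) \<in> a}" by (rule all)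
  next
    fix m assume "\<forall>w\<in>Domain a. card {y \<in> X. (w, y) \<in> a} = m"
    from bspec[OF this x] show "m = card {y \<in> X. (x, y) \<in> a}" by (rule sym)
  qed
qed

section \<open>The matrix $O_{(X,S)}$\<close>

definition normalized_intersection_number ::
  "'a set \<Rightarrow> 'a rel \<Rightarrow> 'a rel \<Rightarrow> 'a rel \<Rightarrow> real" where
  "normalized_intersection_number X a b c =
     sqrt (real (valency X c) / (real (valency X a) * real (valency X b))) *
     real (intersection_number X a b c)"

definition O_entry :: "'a set \<Rightarrow> 'a rel set \<Rightarrow> 'a rel \<Rightarrow> 'a rel \<Rightarrow> real" where
  "O_entry X S a b =
     (\<Sum>p\<in>S. \<Sum>q\<in>S.
        normalized_intersection_number X p q a * normalized_intersection_number X p q b)"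

section \<open>Eigenvalues of a matrix indexed by a finite set\<close>

definition enumerated_mat :: "'i list \<Rightarrow> ('i \<Rightarrow> 'i \<Rightarrow> 'c) \<Rightarrow> 'c mat" where
  "enumerated_mat xs M = mat (length xs) (length xs) (\<lambda>(i, j). M (xs ! i) (xs ! j))"

lemma char_poly_enumerated_mat_unique:
  fixes M :: "'i \<Rightarrow> 'i \<Rightarrow> 'c :: comm_ring_1"
  assumes xs: "distinct xs" "set xs = I" and ys: "distinct ys" "set ys = I"
  shows "char_poly (enumerated_mat xs M) = char_poly (enumerated_mat ys M)"
proof (rule char_poly_similar)
  define n where "n = length xs"
  have len: "length ys = n" unfolding n_def using xs ys by (metis distinct_card)
  define P :: "'c mat" where "P = mat n n (\<lambda>(i, j). of_bool (xs ! i = ys ! j))"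
  define Q :: "'c mat" where "Q = mat n n (\<lambda>(i, j). of_bool (ys ! i = xs ! j))"
  have sumx: "(\<Sum>k<n. of_bool (c = xs ! k) * f (xs ! k)) = f c" if "c \<in> I" for c and f :: "'i \<Rightarrow> 'c"
  proof -
    have "bij_betw ((!) xs) {..<n} I" using bij_betw_nth[OF xs(1), of "{..<n}" I] xs(2) by (simp add: n_def)
    hence "(\<Sum>k<n. of_bool (c = xs ! k) * f (xs ! k)) = (\<Sum>z\<in>I. of_bool (c = z) * f z)"
      by (rule sum.reindex_bij_betw)
    also have "\<dots> = (\<Sum>z\<in>I. if z = c then f z else 0)" by (intro sum.cong) auto
    finally show ?thesis using that xs(2) by (auto simp: sum.delta)
  qed
  have sumy: "(\<Sum>k<n. of_bool (c = ys ! k) * f (ys ! k)) = f c" if "c \<in> I" for c and f :: "'i \<Rightarrow> 'c"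
  proof -
    have "bij_betw ((!) ys) {..<n} I" using bij_betw_nth[OF ys(1), of "{..<n}" I] ys(2) by (simp add: len)
    hence "(\<Sum>k<n. of_bool (c = ys ! k) * f (ys ! k)) = (\<Sum>z\<in>I. of_bool (c = z) * f z)"
      by (rule sum.reindex_bij_betw)
    also have "\<dots> = (\<Sum>z\<in>I. if z = c then f z else 0)" by (intro sum.cong) auto
    finally show ?thesis using that ys(2) by (auto simp: sum.delta)
  qed
  have memx: "xs ! i \<in> I" if "i < n" for i using that xs by (auto simp: n_def)
  have memy: "ys ! i \<in> I" if "i < n" for i using that ys len by auto
  have eqx: "xs ! i = xs ! j \<longleftrightarrow> i = j" if "i < n" "j < n" for i j
    using that xs by (simp add: n_def nth_eq_iff_index_eq)
  have eqy: "ys ! i = ys ! j \<longleftrightarrow> i = j" if "i < n" "j < n" for i j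
    using that ys len by (simp add: nth_eq_iff_index_eq)
  have PB: "P * enumerated_mat ys M = mat n n (\<lambda>(i, j). M (xs ! i) (ys ! j))"
  proof (rule eq_matI)
    fix i j
    assume "i < dim_row (mat n n (\<lambda>(i, j). M (xs ! i) (ys ! j)))"
      and "j < dim_col (mat n n (\<lambda>(i, j). M (xs ! i) (ys ! j)))"
    hence ij: "i < n" "j < n" by auto
    have "(P * enumerated_mat ys M) $$ (i, j) = (\<Sum>k<n. of_bool (xs ! i = ys ! k) * M (ys ! k) (ys ! j))"
      using ij by (simp add: P_def enumerated_mat_def len scalar_prod_def atLeast0LessThan)
    with sumy[OF memx[OF ij(1)], of "\<lambda>z. M z (ys ! j)"] ij
    show "(P * enumerated_mat ys M) $$ (i, j) = mat n n (\<lambda>(i, j). M (xs ! i) (ys ! j)) $$ (i, j)" by simp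
  qed (auto simp: P_def enumerated_mat_def len)
  have PBQ: "enumerated_mat xs M = P * enumerated_mat ys M * Q"
    unfolding PB
  proof (rule eq_matI)
    fix i j
    assume "i < dim_row (mat n n (\<lambda>(i, j). M (xs ! i) (ys ! j)) * Q)"
      and "j < dim_col (mat n n (\<lambda>(i, j). M (xs ! i) (ys ! j)) * Q)"
    hence ij: "i < n" "j < n" by (auto simp: Q_def)
    have "(mat n n (\<lambda>(i, j). M (xs ! i) (ys ! j)) * Q) $$ (i, j)
        = (\<Sum>k<n. of_bool (xs ! j = ys ! k) * M (xs ! i) (ys ! k))"
      using ij by (simp add: Q_def scalar_prod_def atLeast0LessThan mult.commute eq_commute)
    with sumy[OF memx[OF ij(2)], of "\<lambda>z. M (xs ! i) z"] ij
    show "enumerated_mat xs M $$ (i, j) = (mat n n (\<lambda>(i, j). M (xs ! i) (ys ! j)) * Q) $$ (i, j)"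
      by (simp add: enumerated_mat_def n_def)
  qed (auto simp: Q_def enumerated_mat_def n_def)
  have PQ: "P * Q = 1\<^sub>m n"
  proof (rule eq_matI)
    fix i j assume "i < dim_row (1\<^sub>m n :: 'c mat)" "j < dim_col (1\<^sub>m n :: 'c mat)"
    hence ij: "i < n" "j < n" by auto
    have "(P * Q) $$ (i, j) = (\<Sum>k<n. of_bool (xs ! i = ys ! k) * of_bool (ys ! k = xs ! j))"
      using ij by (simp add: P_def Q_def scalar_prod_def atLeast0LessThan)
    with sumy[OF memx[OF ij(1)], of "\<lambda>z. of_bool (z = xs ! j)"] ij eqx[OF ij]
    show "(P * Q) $$ (i, j) = 1\<^sub>m n $$ (i, j)" by simp
  qed (auto simp: P_def Q_def)
  have QP: "Q * P = 1\<^sub>m n"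
  proof (rule eq_matI)
    fix i j assume "i < dim_row (1\<^sub>m n :: 'c mat)" "j < dim_col (1\<^sub>m n :: 'c mat)"
    hence ij: "i < n" "j < n" by auto
    have "(Q * P) $$ (i, j) = (\<Sum>k<n. of_bool (ys ! i = xs ! k) * of_bool (xs ! k = ys ! j))"
      using ij by (simp add: P_def Q_def scalar_prod_def atLeast0LessThan)
    with sumx[OF memy[OF ij(1)], of "\<lambda>z. of_bool (z = ys ! j)"] ij eqy[OF ij]
    show "(Q * P) $$ (i, j) = 1\<^sub>m n $$ (i, j)" by simp
  qed (auto simp: P_def Q_def)
  show "similar_mat (enumerated_mat xs M) (enumerated_mat ys M)"
    by (rule similar_matI[OF _ PQ QP PBQ]) (auto simp: P_def Q_def enumerated_mat_def len n_def)
qed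

text \<open>
  The multiset of eigenvalues, counted with (algebraic) multiplicity, of a real matrix indexed
  by a finite set \<open>I\<close>. The roots are taken in the complex numbers, so that there are exactly
  \<open>card I\<close> of them for any matrix; for a symmetric matrix they are all real. The chosen
  enumeration of the index set is irrelevant by the lemma above.
\<close>

definition eigenvalues_mset :: "'i set \<Rightarrow> ('i \<Rightarrow> 'i \<Rightarrow> real) \<Rightarrow> complex multiset" where
  "eigenvalues_mset I M =
     proots (char_poly (enumerated_mat (SOME xs. distinct xs \<and> set xs = I)
       (\<lambda>i j. complex_of_real (M i j))))"

lemma eigenvalues_mset_eq:
  assumes "distinct xs" "set xs = I"
  shows "eigenvalues_mset I M =
    proots (char_poly (enumerated_mat xs (\<lambda>i j. complex_of_real (M i j))))"
  using char_poly_enumerated_mat_unique[OF assms]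
    someI[of "\<lambda>xs. distinct xs \<and> set xs = I" xs] assms
  unfolding eigenvalues_mset_def by metis

abbreviation O_eigenvalues :: "'a set \<Rightarrow> 'a rel set \<Rightarrow> complex multiset" where
  "O_eigenvalues X S \<equiv> eigenvalues_mset S (O_entry X S)"

section \<open>Morphisms\<close>

definition cc_morphism ::
  "'a set \<Rightarrow> 'a rel set \<Rightarrow> 'b set \<Rightarrow> 'b rel set \<Rightarrow> ('a \<Rightarrow> 'b) \<Rightarrow> ('a rel \<Rightarrow> 'b rel) \<Rightarrow> bool" where
  "cc_morphism X S X' S' \<phi>0 \<phi>1 \<longleftrightarrow>
     \<phi>0 \<in> X \<rightarrow> X' \<and> \<phi>1 \<in> S \<rightarrow> S' \<and>
     (\<forall>a\<in>S. \<forall>x y. (x, y) \<in> a \<longrightarrow> (\<phi>0 x, \<phi>0 y) \<in> \<phi>1 a)"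

definition admissible ::
  "'a set \<Rightarrow> 'a rel set \<Rightarrow> 'b set \<Rightarrow> ('a \<Rightarrow> 'b) \<Rightarrow> ('a rel \<Rightarrow> 'b rel) \<Rightarrow> bool" where
  "admissible X S X' \<phi>0 \<phi>1 \<longleftrightarrow>
     (\<forall>x\<in>X. \<forall>y'\<in>X'. \<forall>a\<in>S.
        (\<exists>w\<in>X. (x, w) \<in> a) \<and> (\<phi>0 x, y') \<in> \<phi>1 a \<longrightarrow>
        (\<exists>y\<in>X. \<phi>0 y = y' \<and> (x, y) \<in> a))"

definition surjective_morphism ::
  "'a set \<Rightarrow> 'a rel set \<Rightarrow> 'b set \<Rightarrow> 'b rel set \<Rightarrow> ('a \<Rightarrow> 'b) \<Rightarrow> ('a rel \<Rightarrow> 'b rel) \<Rightarrow> bool" where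
  "surjective_morphism X S X' S' \<phi>0 \<phi>1 \<longleftrightarrow> \<phi>0 ` X = X' \<and> \<phi>1 ` S = S'"

end

theory Submission
  imports Defs "Jordan_Normal_Form.Jordan_Normal_Form_Existence"
begin

text \<open>
  All fibres of \<open>\<phi>0\<close> have the same size \<open>k\<close>, namely the sum of the valencies of the relations that
  \<open>\<phi>1\<close> sends to the identity. Admissibility makes the number of lifts \<open>(x, y) \<in> p\<close> of a pair in
  \<open>\<phi>1 p\<close> with prescribed first point depend on \<open>p\<close> only, and double counting then relates the
  structure constants of the two schemes. It follows that the linear map sending the basis vector
  \<open>b'\<close> to the sum over all \<open>b\<close> with \<open>\<phi>1 b = b'\<close> of \<open>b\<close> times the square root of
  \<open>\<parallel>b\<parallel> / \<parallel>b'\<parallel>\<close>, which is injective, intertwines \<open>k\<close> times the matrix \<open>O\<close> of the target with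
  the matrix \<open>O\<close> of the source. So the characteristic polynomial of the former divides that of the
  latter.
\<close>

section \<open>Eigenvalues of intertwined matrices\<close>

text \<open>With \<open>V\<close> the matrix having \<open>w i\<close> at \<open>(i, f i)\<close>
  and 0 elsewhere, \<open>intertwine\<close> says \<open>M V = V B\<close>. The columns of
  \<open>V\<close> have disjoint nonempty supports, so \<open>V\<close> is injective and
  \<open>B\<close> describes the action of \<open>M\<close> on its image.\<close>

lemma char_poly_enumerated_mat_dvd:
  fixes M :: "'i \<Rightarrow> 'i \<Rightarrow> 'c :: field" and xs :: "'j list"
  assumes xs: "distinct xs" "set xs = J" and ys: "distinct ys" "set ys = I"
    and surj: "f ` I = J" and w: "\<And>i. i \<in> I \<Longrightarrow> w i \<noteq> 0"
    and intertwine: "\<And>i j. i \<in> I \<Longrightarrow> j \<in> J \<Longrightarrow>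
      (\<Sum>i'\<in>{i'\<in>I. f i' = j}. M i i' * w i') = w i * B (f i) j"
  shows "char_poly (enumerated_mat xs B) dvd char_poly (enumerated_mat ys M)"
proof -
  define s where "s j = (SOME i. i \<in> I \<and> f i = j)" for j
  have s: "s j \<in> I" "f (s j) = j" if "j \<in> J" for j
    using someI_ex[of "\<lambda>i. i \<in> I \<and> f i = j"] that surj unfolding s_def by auto
  have finI: "finite I" and finJ: "finite J" using xs ys by auto
  obtain rest where rest: "distinct rest" "set rest = I - s ` J"
    using finite_distinct_list[of "I - s ` J"] finI by auto
  define zs where "zs = map s xs @ rest"
  define m where "m = length xs"
  define N where "N = length zs"
  have mN: "m \<le> N" by (simp add: m_def N_def zs_def)
  have "inj_on s J" by (rule inj_on_inverseI[where g = f]) (use s in auto)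
  hence zs: "distinct zs" "set zs = I"
    using xs rest s by (auto simp: zs_def distinct_map)
  have zsI: "zs ! i \<in> I" if "i < N" for i using that zs by (auto simp: N_def)
  have xsJ: "xs ! i \<in> J" if "i < m" for i using that xs by (auto simp: m_def)
  have fzs: "f (zs ! i) = xs ! i" if "i < m" for i
    using that s xsJ by (simp add: zs_def m_def nth_append)
  have xs_eq: "xs ! i = xs ! j \<longleftrightarrow> i = j" if "i < m" "j < m" for i j
    using that xs by (simp add: m_def nth_eq_iff_index_eq)
  have zs_eq: "zs ! i = zs ! j \<longleftrightarrow> i = j" if "i < N" "j < N" for i j
    using that zs by (simp add: N_def nth_eq_iff_index_eq)
  have sum_zs: "(\<Sum>k<N. g (zs ! k)) = (\<Sum>i\<in>I. g i)" for g :: "'i \<Rightarrow> 'c poly"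
    using sum.reindex_bij_betw[OF bij_betw_nth[OF zs(1), of "{..<N}" I], of g] zs(2)
    by (simp add: N_def)
  have sum_xs: "(\<Sum>k<m. if j = xs ! k then g (xs ! k) else 0) = g j" if "j \<in> J"
    for j and g :: "'j \<Rightarrow> 'c poly"
    using sum.reindex_bij_betw[OF bij_betw_nth[OF xs(1), of "{..<m}" J],
        of "\<lambda>k. if j = k then g k else 0"] xs(2) that finJ
    by (simp add: m_def)
  define CA where "CA = char_poly_matrix (enumerated_mat zs M)"
  define CB where "CB = char_poly_matrix (enumerated_mat xs B)"
  have CA: "CA \<in> carrier_mat N N" and CB: "CB \<in> carrier_mat m m"
    by (simp_all add: CA_def CB_def enumerated_mat_def m_def N_def)
  have CAij: "CA $$ (i, j) = (if i = j then [:0, 1:] else 0) - [:M (zs ! i) (zs ! j):]"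
    if "i < N" "j < N" for i j
    using that by (simp add: CA_def char_poly_matrix_def enumerated_mat_def N_def)
  have CBij: "CB $$ (i, j) = (if i = j then [:0, 1:] else 0) - [:B (xs ! i) (xs ! j):]"
    if "i < m" "j < m" for i j
    using that by (simp add: CB_def char_poly_matrix_def enumerated_mat_def m_def)
  txt \<open>
    With \<open>V\<close> the matrix of \<open>v\<close> (so \<open>M V = V B\<close>), the columns of \<open>P\<close> are those of \<open>V\<close> followed by unit
    vectors, and \<open>(x - M) P = Q K\<close> with \<open>Q = [V, (x - M) E]\<close> and \<open>K = diag (x - B, 1)\<close>. Listing
    representatives of the fibres first makes \<open>P\<close> lower triangular with a nonzero constant determinant,
    so no inverse of \<open>P\<close> is needed.
  \<close>
  define v where "v i j = (if f (zs ! i) = xs ! j then [:w (zs ! i):] else 0)" for i j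
  define P where "P = mat N N (\<lambda>(i, j). if j < m then v i j else if i = j then 1 else 0)"
  define Q where "Q = mat N N (\<lambda>(i, j). if j < m then v i j else CA $$ (i, j))"
  define K where "K = four_block_mat CB (0\<^sub>m m (N - m)) (0\<^sub>m (N - m) m) (1\<^sub>m (N - m))"
  have P: "P \<in> carrier_mat N N" and Q: "Q \<in> carrier_mat N N"
    by (simp_all add: P_def Q_def)
  have K: "K \<in> carrier_mat N N"
    using four_block_carrier_mat[OF CB one_carrier_mat[of "N - m"]] mN by (simp add: K_def)
  have Kij: "K $$ (i, j) = (if i < m \<and> j < m then CB $$ (i, j) else if i = j then 1 else 0)"
    if "i < N" "j < N" for i j
    using that CB mN by (auto simp: K_def)
  have "CA * P = Q * K"
  proof (rule eq_matI)
    fix i j assume "i < dim_row (Q * K)" "j < dim_col (Q * K)"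
    hence i: "i < N" and j: "j < N" using Q K by auto
    have L: "(CA * P) $$ (i, j) = (\<Sum>k<N. CA $$ (i, k) * P $$ (k, j))"
      using i j CA P by (simp add: scalar_prod_def atLeast0LessThan)
    have R: "(Q * K) $$ (i, j) = (\<Sum>k<N. Q $$ (i, k) * K $$ (k, j))"
      using i j Q K by (simp add: scalar_prod_def atLeast0LessThan)
    show "(CA * P) $$ (i, j) = (Q * K) $$ (i, j)"
    proof (cases "j < m")
      \<comment> \<open>\<open>P\<close> and \<open>K\<close> both have a unit vector as column
        \<open>j\<close>, so both sides are column \<open>j\<close> of \<open>CA\<close>.\<close>
      case False
      have "(CA * P) $$ (i, j) = (\<Sum>k<N. if k = j then CA $$ (i, k) else 0)"
        unfolding L using False i j by (intro sum.cong) (auto simp: P_def)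
      also have "\<dots> = (\<Sum>k<N. if k = j then Q $$ (i, k) else 0)"
        using False i j by (intro sum.cong) (auto simp: Q_def)
      also have "\<dots> = (Q * K) $$ (i, j)"
        unfolding R using False i j by (intro sum.cong) (auto simp: Kij)
      finally show ?thesis .
    next
      \<comment> \<open>Entry \<open>(i, j)\<close> of \<open>(x - M) V = V (x - B)\<close>: on the
        right only the column of \<open>f (zs ! i)\<close> contributes, as row \<open>i\<close> of
        \<open>V\<close> has one nonzero entry.\<close>
      case True
      let ?i = "zs ! i" and ?j = "xs ! j"
      have iI: "?i \<in> I" and jJ: "?j \<in> J" and fi: "f ?i \<in> J" using i True zsI xsJ surj by auto
      have "(CA * P) $$ (i, j) = (\<Sum>k<N. (if zs ! k = ?i then [:0, 1:] * v i j else 0)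
          - (if f (zs ! k) = ?j then [:M ?i (zs ! k) * w (zs ! k):] else 0))"
        unfolding L using True i j
        by (intro sum.cong) (auto simp: P_def CAij v_def zs_eq algebra_simps)
      also have "\<dots> = (\<Sum>k\<in>I. (if k = ?i then [:0, 1:] * v i j else 0)
          - (if f k = ?j then [:M ?i k * w k:] else 0))"
        by (rule sum_zs)
      also have "\<dots> = [:0, 1:] * v i j - (\<Sum>k\<in>{k\<in>I. f k = ?j}. [:M ?i k * w k:])"
        using iI finI by (simp add: sum_subtractf sum.inter_filter)
      also have "(\<Sum>k\<in>{k\<in>I. f k = ?j}. [:M ?i k * w k:]) = [:\<Sum>k\<in>{k\<in>I. f k = ?j}. M ?i k * w k:]"
        by (rule sum_to_poly)
      also have "\<dots> = [:w ?i * B (f ?i) ?j:]"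
        by (simp only: intertwine[OF iI jJ])
      finally have left: "(CA * P) $$ (i, j) = [:0, 1:] * v i j - [:w ?i * B (f ?i) ?j:]" .
      have "(Q * K) $$ (i, j) = (\<Sum>k<m. Q $$ (i, k) * K $$ (k, j))"
        unfolding R using True i j mN by (intro sum.mono_neutral_right) (auto simp: Kij)
      also have "\<dots> = (\<Sum>k<m. if f ?i = xs ! k
          then [:w ?i:] * ((if xs ! k = ?j then [:0, 1:] else 0) - [:B (xs ! k) ?j:]) else 0)"
        using True i j mN by (intro sum.cong) (auto simp: Q_def Kij CBij v_def xs_eq)
      also have "\<dots> = [:w ?i:] * ((if f ?i = ?j then [:0, 1:] else 0) - [:B (f ?i) ?j:])"
        by (rule sum_xs[OF fi])
      finally have right: "(Q * K) $$ (i, j)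
        = [:w ?i:] * ((if f ?i = ?j then [:0, 1:] else 0) - [:B (f ?i) ?j:])" .
      show ?thesis unfolding left right v_def by auto
    qed
  qed (use CA P Q K in auto)
  hence dets: "det CA * det P = det Q * det K"
    using det_mult[OF CA P] det_mult[OF Q K] by simp
  have detK: "det K = det CB"
    unfolding K_def by (subst det_four_block_mat_upper_right_zero[OF CB refl _ one_carrier_mat]) auto
  have detP: "det P = prod_list (diag_mat P)"
  proof (rule det_lower_triangular[OF _ P])
    \<comment> \<open>Above the diagonal in the first \<open>m\<close> columns,
      \<open>zs ! i\<close> represents the fibre of \<open>xs ! i\<close>, not that of
      \<open>xs ! j\<close>.\<close>
    fix i j assume "i < j" "j < N"
    thus "P $$ (i, j) = 0" by (auto simp: P_def v_def fzs xs_eq)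
  qed
  have "is_unit (prod_list (diag_mat P))"
  proof -
    have "is_unit (P $$ (i, i))" if "i < N" for i
      using that w[OF zsI[OF that]] by (auto simp: P_def v_def fzs is_unit_pCons_iff)
    hence "\<forall>x\<in>set (diag_mat P). is_unit x" using P by (auto simp: diag_mat_def)
    moreover have "\<forall>x\<in>set l. is_unit x \<Longrightarrow> is_unit (prod_list l)" for l :: "'c poly list"
      by (induction l) (auto simp: degree_mult_eq prod_list_zero_iff)
    ultimately show ?thesis by blast
  qed
  hence "det CB dvd det CA"
    using dets detK detP by (metis dvd_mult_unit_iff dvd_triv_right)
  moreover have "char_poly (enumerated_mat ys M) = det CA"
    unfolding CA_def char_poly_def[symmetric] by (rule char_poly_enumerated_mat_unique[OF ys zs])
  ultimately show ?thesis by (simp add: CB_def char_poly_def)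
qed

text \<open>The real identity is read over the complex numbers. The root multiset of a product of
  nonzero polynomials is the sum of the root multisets, so divisibility becomes inclusion.\<close>

lemma eigenvalues_mset_subset:
  fixes M :: "'i \<Rightarrow> 'i \<Rightarrow> real"
  assumes I: "finite I" and surj: "f ` I = J" and w: "\<And>i. i \<in> I \<Longrightarrow> w i \<noteq> 0"
    and intertwine: "\<And>i j. i \<in> I \<Longrightarrow> j \<in> J \<Longrightarrow>
      (\<Sum>i'\<in>{i'\<in>I. f i' = j}. M i i' * w i') = w i * B (f i) j"
  shows "eigenvalues_mset J B \<subseteq># eigenvalues_mset I M"
proof -
  obtain xs where xs: "distinct xs" "set xs = J" using finite_distinct_list[of J] surj I by auto
  obtain ys where ys: "distinct ys" "set ys = I" using finite_distinct_list[OF I] by auto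
  let ?A = "enumerated_mat ys (\<lambda>i j. complex_of_real (M i j))"
  have "char_poly (enumerated_mat xs (\<lambda>i j. complex_of_real (B i j))) dvd char_poly ?A"
  proof (rule char_poly_enumerated_mat_dvd[OF xs ys surj, where w = "\<lambda>i. complex_of_real (w i)"])
    fix i j assume "i \<in> I" "j \<in> J"
    from arg_cong[OF intertwine[OF this], of complex_of_real]
    show "(\<Sum>i'\<in>{i'\<in>I. f i' = j}. complex_of_real (M i i') * complex_of_real (w i'))
        = complex_of_real (w i) * complex_of_real (B (f i) j)" by simp
  qed (use w in auto)
  then obtain r where r: "char_poly ?A =
      char_poly (enumerated_mat xs (\<lambda>i j. complex_of_real (B i j))) * r" by (elim dvdE)
  have "char_poly ?A \<noteq> 0"
    using degree_monic_char_poly[of ?A "length ys"] by (auto simp: enumerated_mat_def)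
  thus ?thesis
    unfolding eigenvalues_mset_eq[OF xs] eigenvalues_mset_eq[OF ys] r
    by (subst proots_mult) auto
qed

text \<open>For nonzero \<open>c\<close> the multiplicity of \<open>x\<close> as a root for
  \<open>c M\<close> equals that of \<open>x / c\<close> for \<open>M\<close>.\<close>

lemma eigenvalues_mset_scale:
  assumes I: "finite I" and c: "c \<noteq> 0"
  shows "eigenvalues_mset I (\<lambda>i j. c * M i j)
    = image_mset (\<lambda>z. complex_of_real c * z) (eigenvalues_mset I M)"
proof -
  obtain xs where xs: "distinct xs" "set xs = I" using finite_distinct_list[OF I] by auto
  define A where "A = enumerated_mat xs (\<lambda>i j. complex_of_real (M i j))"
  have A: "A \<in> carrier_mat (length xs) (length xs)" by (simp add: A_def enumerated_mat_def)
  hence cA: "complex_of_real c \<cdot>\<^sub>m A \<in> carrier_mat (length xs) (length xs)" by simp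
  have scale: "enumerated_mat xs (\<lambda>i j. complex_of_real (c * M i j)) = complex_of_real c \<cdot>\<^sub>m A"
    by (rule eq_matI) (auto simp: A_def enumerated_mat_def)
  have nz: "char_poly A \<noteq> 0" "char_poly (complex_of_real c \<cdot>\<^sub>m A) \<noteq> 0"
    using degree_monic_char_poly[OF A] degree_monic_char_poly[OF cA] by auto
  have "proots (char_poly (complex_of_real c \<cdot>\<^sub>m A))
      = image_mset (\<lambda>z. complex_of_real c * z) (proots (char_poly A))"
  proof (rule multiset_eqI)
    fix x
    have "{y. y \<in># proots (char_poly A) \<and> x = complex_of_real c * y}
        = (if x / complex_of_real c \<in># proots (char_poly A) then {x / complex_of_real c} else {})"
      using c by (auto simp: field_simps)
    hence "count (image_mset (\<lambda>z. complex_of_real c * z) (proots (char_poly A))) x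
        = count (proots (char_poly A)) (x / complex_of_real c)"
      by (simp add: count_image_mset' not_in_iff del: count_proots set_count_proots)
    thus "count (proots (char_poly (complex_of_real c \<cdot>\<^sub>m A))) x
        = count (image_mset (\<lambda>z. complex_of_real c * z) (proots (char_poly A))) x"
      using c nz order_char_poly_smult[OF A, of "complex_of_real c" x] by simp
  qed
  thus ?thesis unfolding eigenvalues_mset_eq[OF xs] scale A_def .
qed

text \<open>The counting principle by which numbers in the source scheme are compared with numbers
  in the target: \<open>g\<close> will be \<open>\<phi>0\<close>, or \<open>\<phi>0\<close> on both
  components of a pair.\<close>

lemma card_eq_card_fibre_times:
  assumes "finite D" "finite W" "g ` D \<subseteq> W" and "\<And>w. w \<in> W \<Longrightarrow> card {d \<in> D. g d = w} = k"
  shows "card D = k * card W"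
proof -
  have "card D = (\<Sum>w\<in>W. \<Sum>d\<in>{d \<in> D. g d = w}. 1)"
    using sum.group[OF assms(1-3), of "\<lambda>_. 1 :: nat"] by simp
  also have "\<dots> = k * card W" using assms(4) by simp
  finally show ?thesis .
qed

section \<open>Association schemes\<close>

locale scheme =
  fixes X :: "'a set" and S :: "'a rel set"
  assumes scheme: "association_scheme X S"
begin

lemma coherent: "coherent_configuration X S"
  using scheme by (simp add: association_scheme_def)

lemma Id_in: "Id_on X \<in> S"
  using scheme by (simp add: association_scheme_def)

lemma finite_points: "finite X"
  using coherent by (simp add: coherent_configuration_def)

lemma partition: "partition_on (X \<times> X) S"
  using coherent by (simp add: coherent_configuration_def)

lemma finite_relations: "finite S"
  using finite_elements[OF _ partition] finite_points by simp

lemma relation_points: "a \<in> S \<Longrightarrow> (x, y) \<in> a \<Longrightarrow> x \<in> X \<and> y \<in> X"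
  using partition by (auto simp: partition_on_def)

lemma relation_exists:
  assumes "x \<in> X" "y \<in> X"
  obtains a where "a \<in> S" "(x, y) \<in> a"
  using partition assms by (auto simp: partition_on_def)

lemma relation_unique: "a \<in> S \<Longrightarrow> b \<in> S \<Longrightarrow> (x, y) \<in> a \<Longrightarrow> (x, y) \<in> b \<Longrightarrow> a = b"
  using partition by (auto simp: partition_on_def disjoint_def)

lemma relation_nonempty:
  assumes "a \<in> S"
  obtains x y where "(x, y) \<in> a"
proof -
  have "a \<noteq> {}" using partition assms by (auto simp: partition_on_def)
  thus ?thesis using that by (metis equals0I surj_pair)
qed

text \<open>Here it enters that the diagonal is a single relation: the number of
  \<open>a\<close>-neighbours of any point is the structure constant of \<open>a\<close> and its
  converse at \<open>Id_on X\<close>, so it is the same at all points, and it is positive at some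
  point.\<close>

lemma domain_relation:
  assumes a: "a \<in> S" and x: "x \<in> X"
  shows "x \<in> Domain a"
proof -
  obtain u v where uv: "(u, v) \<in> a" using relation_nonempty[OF a] .
  hence u: "u \<in> X" and v: "v \<in> X" using relation_points[OF a] by auto
  have conv: "a\<inverse> \<in> S" using coherent a by (simp add: coherent_configuration_def)
  have eq: "intersection_number X a (a\<inverse>) (Id_on X) = card {z \<in> X. (w, z) \<in> a}" if "w \<in> X" for w
    using intersection_number_eq[OF coherent a conv Id_in Id_onI[OF that]] by simp
  have "card {z \<in> X. (u, z) \<in> a} > 0"
    using uv v finite_points by (auto simp: card_gt_0_iff)
  hence "card {z \<in> X. (x, z) \<in> a} > 0" using eq[OF u] eq[OF x] by simp
  thus ?thesis by (auto simp: card_gt_0_iff)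
qed

lemma card_neighbours: "a \<in> S \<Longrightarrow> x \<in> X \<Longrightarrow> card {y \<in> X. (x, y) \<in> a} = valency X a"
  using valency_eq[OF coherent _ domain_relation] by simp

lemma valency_pos:
  assumes "a \<in> S"
  shows "valency X a > 0"
proof -
  obtain x y where xy: "(x, y) \<in> a" using relation_nonempty[OF assms] .
  hence "x \<in> X" "y \<in> X" using relation_points[OF assms] by auto
  moreover from this have "card {y \<in> X. (x, y) \<in> a} > 0"
    using xy finite_points by (auto simp: card_gt_0_iff)
  ultimately show ?thesis using card_neighbours[OF assms] by simp
qed

text \<open>The root of \<open>valency X p * valency X q\<close> occurs twice and disappears, so
  that the sum consists of quotients of counts, to which double counting applies.\<close>

lemma O_entry_eq:
  "O_entry X S a b = sqrt (valency X a) * sqrt (valency X b) *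
    (\<Sum>p\<in>S. \<Sum>q\<in>S. real (intersection_number X p q a) * real (intersection_number X p q b)
      / (real (valency X p) * real (valency X q)))"
proof -
  have "normalized_intersection_number X p q a * normalized_intersection_number X p q b
      = sqrt (valency X a) * sqrt (valency X b) *
        (real (intersection_number X p q a) * real (intersection_number X p q b)
          / (real (valency X p) * real (valency X q)))" for p q
  proof -
    define y where "y = real (valency X p) * real (valency X q)"
    have "sqrt y * sqrt y = y" by (simp add: y_def)
    hence "sqrt (real (valency X a) / y) * sqrt (real (valency X b) / y)
        = sqrt (valency X a) * sqrt (valency X b) / y"
      by (simp add: real_sqrt_divide)
    thus ?thesis
      unfolding normalized_intersection_number_def y_def[symmetric] by (simp add: field_simps)
  qed
  thus ?thesis unfolding O_entry_def by (simp add: sum_distrib_left)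
qed

end

section \<open>Surjective admissible morphisms\<close>

locale admissible_surjection = dom: scheme X S + cod: scheme X' S'
  for X :: "'a set" and S :: "'a rel set" and X' :: "'b set" and S' :: "'b rel set" +
  fixes \<phi>0 :: "'a \<Rightarrow> 'b" and \<phi>1 :: "'a rel \<Rightarrow> 'b rel"
  assumes morphism: "cc_morphism X S X' S' \<phi>0 \<phi>1"
    and admissible: "admissible X S X' \<phi>0 \<phi>1"
    and surjective: "surjective_morphism X S X' S' \<phi>0 \<phi>1"
begin

section \<open>Elementary properties of the two maps\<close>

lemma point_map: "x \<in> X \<Longrightarrow> \<phi>0 x \<in> X'"
  using surjective by (auto simp: surjective_morphism_def)

lemma relation_map: "a \<in> S \<Longrightarrow> \<phi>1 a \<in> S'"
  using surjective by (auto simp: surjective_morphism_def)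

lemma map_related: "a \<in> S \<Longrightarrow> (x, y) \<in> a \<Longrightarrow> (\<phi>0 x, \<phi>0 y) \<in> \<phi>1 a"
  using morphism by (auto simp: cc_morphism_def)

text \<open>Distinct relations of the target are disjoint, so one pair decides where
  \<open>\<phi>1\<close> sends \<open>a\<close>. This translates between fibres of
  \<open>\<phi>1\<close> and conditions on points.\<close>

lemma relation_map_eq_iff:
  assumes "a \<in> S" "(x, y) \<in> a" "a' \<in> S'"
  shows "\<phi>1 a = a' \<longleftrightarrow> (\<phi>0 x, \<phi>0 y) \<in> a'"
  using cod.relation_unique[OF relation_map[OF assms(1)] assms(3) map_related[OF assms(1,2)]]
    map_related[OF assms(1,2)] by auto

lemma point_surj:
  assumes "x' \<in> X'"
  obtains x where "x \<in> X" "\<phi>0 x = x'"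
  using surjective assms by (auto simp: surjective_morphism_def)

lemma lift_exists:
  assumes "x \<in> X" "y' \<in> X'" "p \<in> S" "(\<phi>0 x, y') \<in> \<phi>1 p"
  obtains y where "y \<in> X" "\<phi>0 y = y'" "(x, y) \<in> p"
proof -
  have "\<exists>w\<in>X. (x, w) \<in> p"
    using dom.domain_relation[OF assms(3,1)] dom.relation_points[OF assms(3)] by (auto elim!: DomainE)
  hence "\<exists>y\<in>X. \<phi>0 y = y' \<and> (x, y) \<in> p"
    using admissible[unfolded admissible_def, rule_format, OF assms(1-3)] assms(4) by simp
  thus ?thesis using that by auto
qed

section \<open>Fibres of the map on points\<close>

definition kernel :: "'a rel set" where
  "kernel = {t \<in> S. \<phi>1 t = Id_on X'}"

text \<open>The relation through \<open>(x, y)\<close> lies in \<open>kernel\<close> exactly if the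
  image pair is diagonal. Thus the union of \<open>kernel\<close> is the equivalence relation whose
  classes are the fibres of \<open>\<phi>0\<close>.\<close>

lemma same_fibre_iff:
  assumes "x \<in> X" "y \<in> X"
  shows "\<phi>0 x = \<phi>0 y \<longleftrightarrow> (\<exists>t\<in>kernel. (x, y) \<in> t)"
proof -
  obtain a where a: "a \<in> S" "(x, y) \<in> a" using dom.relation_exists assms by blast
  have "\<phi>0 x = \<phi>0 y \<longleftrightarrow> (\<phi>0 x, \<phi>0 y) \<in> Id_on X'"
    using point_map[OF assms(1)] by (simp add: Id_on_iff)
  also have "\<dots> \<longleftrightarrow> a \<in> kernel"
    using relation_map_eq_iff[OF a cod.Id_in] a(1) by (simp add: kernel_def)
  also have "\<dots> \<longleftrightarrow> (\<exists>t\<in>kernel. (x, y) \<in> t)"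
    unfolding kernel_def using a dom.relation_unique by blast
  finally show ?thesis .
qed

lemma finite_kernel: "finite kernel"
  using dom.finite_relations by (simp add: kernel_def)

definition fibre_size :: nat where
  "fibre_size = (\<Sum>t\<in>kernel. valency X t)"

text \<open>As \<open>\<phi>0\<close> is onto, the fibre contains some \<open>x\<close>, and it is
  the disjoint union of the neighbourhoods of \<open>x\<close> for the relations in
  \<open>kernel\<close>, whose sizes are valencies.\<close>

lemma card_fibre:
  assumes "x' \<in> X'"
  shows "card {y \<in> X. \<phi>0 y = x'} = fibre_size"
proof -
  obtain x where x: "x \<in> X" "\<phi>0 x = x'" using point_surj[OF assms] .
  have "{y \<in> X. \<phi>0 y = x'} = (\<Union>t\<in>kernel. {y \<in> X. (x, y) \<in> t})"
    using same_fibre_iff[OF x(1)] x by (auto simp: eq_commute)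
  also have "card \<dots> = (\<Sum>t\<in>kernel. card {y \<in> X. (x, y) \<in> t})"
    by (rule card_UN_disjoint)
      (use finite_kernel dom.finite_points in \<open>auto simp: kernel_def dest: dom.relation_unique\<close>)
  also have "\<dots> = fibre_size"
    unfolding fibre_size_def using dom.card_neighbours x by (intro sum.cong) (auto simp: kernel_def)
  finally show ?thesis .
qed

lemma fibre_size_pos: "fibre_size > 0"
proof -
  obtain x y where "(x, y) \<in> Id_on X" using dom.relation_nonempty[OF dom.Id_in] .
  hence x: "x \<in> X" by auto
  hence "card {y \<in> X. \<phi>0 y = \<phi>0 x} > 0" using dom.finite_points by (auto simp: card_gt_0_iff)
  thus ?thesis using card_fibre[OF point_map[OF x]] by simp
qed

section \<open>Lifts of a pair\<close>

definition lift_number :: "'a rel \<Rightarrow> nat" where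
  "lift_number p = (\<Sum>t\<in>kernel. intersection_number X p t p)"

text \<open>Admissibility gives one lift \<open>y\<close>. The lifts \<open>z\<close> are sorted by
  the relation \<open>t\<close> in \<open>kernel\<close> that contains \<open>(z, y)\<close>; each
  class is counted by the structure constant of \<open>p\<close> and \<open>t\<close> at
  \<open>(x, y) \<in> p\<close>, which depends on neither \<open>x\<close> nor \<open>y'\<close>.
  This explains the formula for \<open>lift_number\<close>.\<close>

lemma card_lifts:
  assumes p: "p \<in> S" and x: "x \<in> X" and y': "y' \<in> X'" and xy': "(\<phi>0 x, y') \<in> \<phi>1 p"
  shows "card {y \<in> X. \<phi>0 y = y' \<and> (x, y) \<in> p} = lift_number p"
proof -
  obtain y where y: "y \<in> X" "\<phi>0 y = y'" "(x, y) \<in> p" using lift_exists[OF x y' p xy'] .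
  have "{z \<in> X. \<phi>0 z = y' \<and> (x, z) \<in> p} = (\<Union>t\<in>kernel. {z \<in> X. (x, z) \<in> p \<and> (z, y) \<in> t})"
    using same_fibre_iff[OF _ y(1)] y by auto
  also have "card \<dots> = (\<Sum>t\<in>kernel. card {z \<in> X. (x, z) \<in> p \<and> (z, y) \<in> t})"
    by (rule card_UN_disjoint)
      (use finite_kernel dom.finite_points in \<open>auto simp: kernel_def dest: dom.relation_unique\<close>)
  also have "\<dots> = lift_number p"
    unfolding lift_number_def using intersection_number_eq[OF dom.coherent p _ p y(3)]
    by (intro sum.cong) (auto simp: kernel_def)
  finally show ?thesis .
qed

lemma valency_eq_lift_number:
  assumes p: "p \<in> S"
  shows "valency X p = lift_number p * valency X' (\<phi>1 p)"
proof -
  obtain x y where "(x, y) \<in> p" using dom.relation_nonempty[OF p] .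
  hence x: "x \<in> X" using dom.relation_points[OF p] by auto
  have "card {y \<in> X. (x, y) \<in> p} = lift_number p * card {y' \<in> X'. (\<phi>0 x, y') \<in> \<phi>1 p}"
  proof (rule card_eq_card_fibre_times[where g = \<phi>0])
    fix w assume w: "w \<in> {y' \<in> X'. (\<phi>0 x, y') \<in> \<phi>1 p}"
    have "{d \<in> {y \<in> X. (x, y) \<in> p}. \<phi>0 d = w} = {y \<in> X. \<phi>0 y = w \<and> (x, y) \<in> p}" by auto
    thus "card {d \<in> {y \<in> X. (x, y) \<in> p}. \<phi>0 d = w} = lift_number p"
      using card_lifts[OF p x] w by simp
  qed (use dom.finite_points cod.finite_points point_map map_related[OF p] in auto)
  thus ?thesis
    using dom.card_neighbours[OF p x] cod.card_neighbours[OF relation_map[OF p] point_map[OF x]]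
    by simp
qed

section \<open>Structure constants and the intertwining relation\<close>

text \<open>Both sides count, for a fixed \<open>x\<close>, the pairs \<open>(y, z)\<close> with \<open>(x, z) \<in> p\<close>, \<open>(z, y) \<in> q\<close> and
  \<open>(\<phi>0 x, \<phi>0 y) \<in> b'\<close>.\<close>

lemma sum_valency_intersection_number:
  assumes p: "p \<in> S" and q: "q \<in> S" and b': "b' \<in> S'"
  shows "(\<Sum>b\<in>{b \<in> S. \<phi>1 b = b'}. valency X b * intersection_number X p q b)
    = lift_number p * lift_number q *
      (valency X' b' * intersection_number X' (\<phi>1 p) (\<phi>1 q) b')"
proof -
  obtain x y where "(x, y) \<in> p" using dom.relation_nonempty[OF p] .
  hence x: "x \<in> X" using dom.relation_points[OF p] by auto
  define Y where "Y = {y \<in> X. (\<phi>0 x, \<phi>0 y) \<in> b'}"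
  define Z where "Z y = {z \<in> X. (x, z) \<in> p \<and> (z, y) \<in> q}" for y
  define Y' where "Y' = {y' \<in> X'. (\<phi>0 x, y') \<in> b'}"
  define Z' where "Z' y' = {z' \<in> X'. (\<phi>0 x, z') \<in> \<phi>1 p \<and> (z', y') \<in> \<phi>1 q}" for y'
  have fin: "finite Y" "finite (Z y)" "finite Y'" "finite (Z' y')" for y y'
    using dom.finite_points cod.finite_points by (simp_all add: Y_def Z_def Y'_def Z'_def)
  have Y: "Y = (\<Union>b\<in>{b \<in> S. \<phi>1 b = b'}. {y \<in> X. (x, y) \<in> b})"
    using relation_map_eq_iff[OF _ _ b'] dom.relation_exists[OF x] unfolding Y_def
    by (auto simp: set_eq_iff) metis
  have "card (Sigma Y Z) = (\<Sum>y\<in>Y. card (Z y))"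
    using fin by (simp add: card_SigmaI)
  also have "\<dots> = (\<Sum>b\<in>{b \<in> S. \<phi>1 b = b'}. \<Sum>y\<in>{y \<in> X. (x, y) \<in> b}. card (Z y))"
    unfolding Y using dom.finite_relations dom.finite_points
    by (intro sum.UNION_disjoint) (auto dest: dom.relation_unique)
  also have "\<dots> = (\<Sum>b\<in>{b \<in> S. \<phi>1 b = b'}. valency X b * intersection_number X p q b)"
  proof (rule sum.cong[OF refl])
    fix b assume "b \<in> {b \<in> S. \<phi>1 b = b'}"
    hence b: "b \<in> S" by simp
    have "(\<Sum>y\<in>{y \<in> X. (x, y) \<in> b}. card (Z y))
        = (\<Sum>y\<in>{y \<in> X. (x, y) \<in> b}. intersection_number X p q b)"
      using intersection_number_eq[OF dom.coherent p q b]
      by (intro sum.cong) (auto simp: Z_def)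
    thus "(\<Sum>y\<in>{y \<in> X. (x, y) \<in> b}. card (Z y)) = valency X b * intersection_number X p q b"
      using dom.card_neighbours[OF b x] by simp
  qed
  finally have dom_count: "card (Sigma Y Z) = \<dots>" .
  have "card (Sigma Y' Z') = (\<Sum>y'\<in>Y'. card (Z' y'))"
    using fin by (simp add: card_SigmaI)
  also have "\<dots> = (\<Sum>y'\<in>Y'. intersection_number X' (\<phi>1 p) (\<phi>1 q) b')"
    using intersection_number_eq[OF cod.coherent relation_map[OF p] relation_map[OF q] b']
    by (intro sum.cong) (auto simp: Y'_def Z'_def)
  also have "\<dots> = valency X' b' * intersection_number X' (\<phi>1 p) (\<phi>1 q) b'"
    using cod.card_neighbours[OF b' point_map[OF x]] by (simp add: Y'_def)
  finally have cod_count: "card (Sigma Y' Z') = \<dots>" .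
  have "card (Sigma Y Z) = lift_number p * lift_number q * card (Sigma Y' Z')"
  proof (rule card_eq_card_fibre_times[where g = "map_prod \<phi>0 \<phi>0"])
    show "map_prod \<phi>0 \<phi>0 ` Sigma Y Z \<subseteq> Sigma Y' Z'"
      using point_map map_related[OF p] map_related[OF q]
      by (auto simp: Y_def Z_def Y'_def Z'_def)
  next
    fix w assume "w \<in> Sigma Y' Z'"
    then obtain y' z' where w: "w = (y', z')" and y': "y' \<in> X'" "(\<phi>0 x, y') \<in> b'"
      and z': "z' \<in> X'" "(\<phi>0 x, z') \<in> \<phi>1 p" "(z', y') \<in> \<phi>1 q"
      by (auto simp: Y'_def Z'_def)
    let ?P = "{z \<in> X. \<phi>0 z = z' \<and> (x, z) \<in> p}" and ?Q = "\<lambda>z. {y \<in> X. \<phi>0 y = y' \<and> (z, y) \<in> q}"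
    \<comment> \<open>Choose \<open>z\<close> first, as a lift of \<open>z'\<close> from
      \<open>x\<close> along \<open>p\<close>, then \<open>y\<close> as a lift of \<open>y'\<close>
      from \<open>z\<close> along \<open>q\<close>; the number of choices for \<open>y\<close> is
      the same for every \<open>z\<close>. The swap restores the order of the pair.\<close>
    have "{d \<in> Sigma Y Z. map_prod \<phi>0 \<phi>0 d = w} = prod.swap ` Sigma ?P ?Q"
      using y' by (auto simp: w Y_def Z_def image_iff)
    hence "card {d \<in> Sigma Y Z. map_prod \<phi>0 \<phi>0 d = w} = card (Sigma ?P ?Q)"
      by (simp add: card_image)
    also have "\<dots> = (\<Sum>z\<in>?P. card (?Q z))"
      using dom.finite_points by (intro card_SigmaI) auto
    also have "\<dots> = (\<Sum>z\<in>?P. lift_number q)"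
      using card_lifts[OF q _ y'(1)] z' by (intro sum.cong) auto
    also have "\<dots> = lift_number p * lift_number q"
      using card_lifts[OF p x z'(1,2)] by simp
    finally show "card {d \<in> Sigma Y Z. map_prod \<phi>0 \<phi>0 d = w} = lift_number p * lift_number q" .
  qed (use fin in auto)
  thus ?thesis using dom_count cod_count by simp
qed

text \<open>Both sides count, for a fixed \<open>(x, y) \<in> a\<close>, the points \<open>z\<close> with \<open>(\<phi>0 x, \<phi>0 z) \<in> p'\<close> and
  \<open>(\<phi>0 z, \<phi>0 y) \<in> q'\<close>.\<close>

lemma sum_intersection_number:
  assumes p': "p' \<in> S'" and q': "q' \<in> S'" and a: "a \<in> S"
  shows "(\<Sum>p\<in>{p \<in> S. \<phi>1 p = p'}. \<Sum>q\<in>{q \<in> S. \<phi>1 q = q'}. intersection_number X p q a)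
    = fibre_size * intersection_number X' p' q' (\<phi>1 a)"
proof -
  obtain x y where xy: "(x, y) \<in> a" using dom.relation_nonempty[OF a] .
  hence x: "x \<in> X" and y: "y \<in> X" using dom.relation_points[OF a] by auto
  define F where "F = {p \<in> S. \<phi>1 p = p'} \<times> {q \<in> S. \<phi>1 q = q'}"
  define Z where "Z = {z \<in> X. (\<phi>0 x, \<phi>0 z) \<in> p' \<and> (\<phi>0 z, \<phi>0 y) \<in> q'}"
  have Z: "Z = (\<Union>(p, q)\<in>F. {z \<in> X. (x, z) \<in> p \<and> (z, y) \<in> q})"
  proof (rule Set.set_eqI)
    fix z
    show "z \<in> Z \<longleftrightarrow> z \<in> (\<Union>(p, q)\<in>F. {z \<in> X. (x, z) \<in> p \<and> (z, y) \<in> q})"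
    proof (cases "z \<in> X")
      case True
      obtain p q where pq: "p \<in> S" "(x, z) \<in> p" "q \<in> S" "(z, y) \<in> q"
        using dom.relation_exists True x y by metis
      have "z \<in> Z \<longleftrightarrow> (p, q) \<in> F"
        using True pq relation_map_eq_iff[OF pq(1,2) p'] relation_map_eq_iff[OF pq(3,4) q']
        by (simp add: Z_def F_def)
      also have "\<dots> \<longleftrightarrow> z \<in> (\<Union>(p, q)\<in>F. {z \<in> X. (x, z) \<in> p \<and> (z, y) \<in> q})"
        using True pq dom.relation_unique[OF pq(1) _ pq(2)] dom.relation_unique[OF pq(3) _ pq(4)]
        unfolding F_def by blast
      finally show ?thesis .
    qed (auto simp: Z_def)
  qed
  have "(\<Sum>p\<in>{p \<in> S. \<phi>1 p = p'}. \<Sum>q\<in>{q \<in> S. \<phi>1 q = q'}. intersection_number X p q a)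
      = (\<Sum>(p, q)\<in>F. card {z \<in> X. (x, z) \<in> p \<and> (z, y) \<in> q})"
    unfolding F_def sum.cartesian_product
    using intersection_number_eq[OF dom.coherent _ _ a xy] by (intro sum.cong) auto
  also have "\<dots> = card Z"
    unfolding Z case_prod_unfold
    by (rule card_UN_disjoint[symmetric])
      (use dom.finite_relations dom.finite_points in
        \<open>auto simp: F_def dest: dom.relation_unique\<close>)
  also have "\<dots> = fibre_size * card {z' \<in> X'. (\<phi>0 x, z') \<in> p' \<and> (z', \<phi>0 y) \<in> q'}"
  proof (rule card_eq_card_fibre_times[where g = \<phi>0])
    fix w assume w: "w \<in> {z' \<in> X'. (\<phi>0 x, z') \<in> p' \<and> (z', \<phi>0 y) \<in> q'}"
    \<comment> \<open>\<open>Z\<close> is a full preimage under \<open>\<phi>0\<close>, so it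
      contains whole fibres.\<close>
    hence "{d \<in> Z. \<phi>0 d = w} = {z \<in> X. \<phi>0 z = w}" by (auto simp: Z_def)
    thus "card {d \<in> Z. \<phi>0 d = w} = fibre_size" using card_fibre w by simp
  qed (use dom.finite_points cod.finite_points point_map in \<open>auto simp: Z_def\<close>)
  also have "\<dots> = fibre_size * intersection_number X' p' q' (\<phi>1 a)"
    using intersection_number_eq[OF cod.coherent p' q' relation_map[OF a] map_related[OF a xy]]
    by simp
  finally show ?thesis .
qed

text \<open>Summing over \<open>b\<close> first lets the lift numbers cancel against the valencies
  of \<open>p\<close> and \<open>q\<close>; what remains, apart from the structure constant at
  \<open>a\<close>, sees \<open>p\<close> and \<open>q\<close> only through their images. Summing
  that constant over the fibres of \<open>\<phi>1\<close> gives the factor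
  \<open>fibre_size\<close>.\<close>

lemma O_entry_intertwine:
  assumes a: "a \<in> S" and b': "b' \<in> S'"
  shows "(\<Sum>b\<in>{b \<in> S. \<phi>1 b = b'}.
      O_entry X S a b * sqrt (valency X b / valency X' (\<phi>1 b)))
    = sqrt (valency X a / valency X' (\<phi>1 a)) * (real fibre_size * O_entry X' S' (\<phi>1 a) b')"
proof -
  let ?v = "\<lambda>a. real (valency X a)" and ?v' = "\<lambda>a. real (valency X' a)"
  let ?N = "\<lambda>p q a. real (intersection_number X p q a)"
  let ?N' = "\<lambda>p q a. real (intersection_number X' p q a)"
  define G where "G p' q' = ?N' p' q' b' / (?v' p' * ?v' q')" for p' q'
  have pos': "?v' (\<phi>1 p) > 0" if "p \<in> S" for p
    using cod.valency_pos[OF relation_map[OF that]] by simp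
  have b'pos: "?v' b' > 0" using cod.valency_pos[OF b'] by simp
  have weighted: "(\<Sum>b\<in>{b \<in> S. \<phi>1 b = b'}. ?v b * ?N p q b) / (?v p * ?v q)
      = ?v' b' * G (\<phi>1 p) (\<phi>1 q)" if "p \<in> S" "q \<in> S" for p q
  proof -
    have lift: "?v p = real (lift_number p) * ?v' (\<phi>1 p)" "?v q = real (lift_number q) * ?v' (\<phi>1 q)"
      using valency_eq_lift_number that by simp_all
    have "real (lift_number p) \<noteq> 0" "real (lift_number q) \<noteq> 0"
      using valency_eq_lift_number dom.valency_pos that by fastforce+
    moreover have "(\<Sum>b\<in>{b \<in> S. \<phi>1 b = b'}. ?v b * ?N p q b)
        = real (lift_number p * lift_number q *
          (valency X' b' * intersection_number X' (\<phi>1 p) (\<phi>1 q) b'))"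
      unfolding sum_valency_intersection_number[OF that b', symmetric] by simp
    ultimately show ?thesis
      unfolding lift G_def using pos'[OF that(1)] pos'[OF that(2)] by (simp add: field_simps)
  qed
  have "(\<Sum>b\<in>{b \<in> S. \<phi>1 b = b'}. O_entry X S a b * sqrt (?v b / ?v' (\<phi>1 b)))
      = (\<Sum>b\<in>{b \<in> S. \<phi>1 b = b'}. \<Sum>p\<in>S. \<Sum>q\<in>S. sqrt (?v a) / sqrt (?v' b') *
          (?N p q a * (?v b * ?N p q b / (?v p * ?v q))))"
  proof (rule sum.cong[OF refl])
    fix b assume "b \<in> {b \<in> S. \<phi>1 b = b'}"
    hence b: "\<phi>1 b = b'" by simp
    \<comment> \<open>The weight is chosen so that the root of \<open>?v b\<close> becomes
      \<open>?v b\<close> itself, the coefficient that occurs in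
      \<open>sum_valency_intersection_number\<close>.\<close>
    have "sqrt (?v b) * sqrt (?v b / ?v' b') = ?v b / sqrt (?v' b')"
      by (simp add: real_sqrt_divide)
    hence scalar: "sqrt (?v a) * sqrt (?v b) * s * sqrt (?v b / ?v' b')
        = sqrt (?v a) / sqrt (?v' b') * ?v b * s" for s
      by (simp add: field_simps)
    show "O_entry X S a b * sqrt (?v b / ?v' (\<phi>1 b))
        = (\<Sum>p\<in>S. \<Sum>q\<in>S. sqrt (?v a) / sqrt (?v' b') * (?N p q a * (?v b * ?N p q b / (?v p * ?v q))))"
      unfolding dom.O_entry_eq b scalar by (simp add: sum_distrib_left mult_ac)
  qed
  also have "\<dots> = (\<Sum>p\<in>S. \<Sum>q\<in>S. \<Sum>b\<in>{b \<in> S. \<phi>1 b = b'}. sqrt (?v a) / sqrt (?v' b') *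
          (?N p q a * (?v b * ?N p q b / (?v p * ?v q))))"
    by (subst sum.swap, rule sum.cong[OF refl], rule sum.swap)
  also have "\<dots> = (\<Sum>p\<in>S. \<Sum>q\<in>S. sqrt (?v a) / sqrt (?v' b') *
      (?N p q a * (?v' b' * G (\<phi>1 p) (\<phi>1 q))))"
    unfolding sum_distrib_left[symmetric] sum_divide_distrib[symmetric]
    by (intro sum.cong arg_cong2[where f = "(*)"] refl) (simp add: weighted)
  also have "\<dots> = sqrt (?v a) * sqrt (?v' b') * (\<Sum>p\<in>S. \<Sum>q\<in>S. ?N p q a * G (\<phi>1 p) (\<phi>1 q))"
  proof -
    have "sqrt (?v a) / sqrt (?v' b') * (s * (?v' b' * t)) = sqrt (?v a) * sqrt (?v' b') * (s * t)" for s t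
      using b'pos real_sqrt_mult_self[of "?v' b'"] by (simp add: field_simps)
    thus ?thesis by (simp add: sum_distrib_left)
  qed
  \<comment> \<open>The factor with \<open>G\<close> is constant on pairs of fibres of
    \<open>\<phi>1\<close>, so \<open>p\<close> and \<open>q\<close> are grouped by their
    images.\<close>
  also have "(\<Sum>p\<in>S. \<Sum>q\<in>S. ?N p q a * G (\<phi>1 p) (\<phi>1 q))
      = (\<Sum>p'\<in>S'. \<Sum>q'\<in>S'. real fibre_size * (?N' p' q' (\<phi>1 a) * G p' q'))"
  proof -
    have group: "(\<Sum>p\<in>S. h p) = (\<Sum>p'\<in>S'. \<Sum>p\<in>{p \<in> S. \<phi>1 p = p'}. h p)" for h :: "'a rel \<Rightarrow> real"
      using dom.finite_relations cod.finite_relations relation_map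
      by (intro sum.group[symmetric]) auto
    have "(\<Sum>p\<in>S. \<Sum>q\<in>S. ?N p q a * G (\<phi>1 p) (\<phi>1 q))
        = (\<Sum>p'\<in>S'. \<Sum>p\<in>{p \<in> S. \<phi>1 p = p'}. \<Sum>q'\<in>S'. \<Sum>q\<in>{q \<in> S. \<phi>1 q = q'}. ?N p q a * G p' q')"
      by (subst group, intro sum.cong refl, subst group, intro sum.cong refl) auto
    also have "\<dots> = (\<Sum>p'\<in>S'. \<Sum>q'\<in>S'. \<Sum>p\<in>{p \<in> S. \<phi>1 p = p'}. \<Sum>q\<in>{q \<in> S. \<phi>1 q = q'}. ?N p q a * G p' q')"
      by (intro sum.cong refl sum.swap)
    also have "\<dots> = (\<Sum>p'\<in>S'. \<Sum>q'\<in>S'. real (\<Sum>p\<in>{p \<in> S. \<phi>1 p = p'}. \<Sum>q\<in>{q \<in> S. \<phi>1 q = q'}.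
        intersection_number X p q a) * G p' q')"
      by (simp add: sum_distrib_right)
    also have "\<dots> = (\<Sum>p'\<in>S'. \<Sum>q'\<in>S'. real fibre_size * (?N' p' q' (\<phi>1 a) * G p' q'))"
      by (intro sum.cong refl) (simp add: sum_intersection_number[OF _ _ a] del: of_nat_sum)
    finally show ?thesis .
  qed
  also have "sqrt (?v a) * sqrt (?v' b') * \<dots>
      = sqrt (?v a / ?v' (\<phi>1 a)) * (real fibre_size * O_entry X' S' (\<phi>1 a) b')"
    unfolding sum_distrib_left[symmetric] cod.O_entry_eq G_def using pos'[OF a]
    by (simp add: real_sqrt_divide)
  finally show ?thesis .
qed

end

theorem theorem9p7:
  fixes X :: "'a set" and S :: "'a rel set"
    and X' :: "'b set" and S' :: "'b rel set"
    and \<phi>0 :: "'a \<Rightarrow> 'b" and \<phi>1 :: "'a rel \<Rightarrow> 'b rel"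
  assumes "association_scheme X S" and "association_scheme X' S'"
    and "cc_morphism X S X' S' \<phi>0 \<phi>1"
    and "admissible X S X' \<phi>0 \<phi>1"
    and "surjective_morphism X S X' S' \<phi>0 \<phi>1"
  shows "\<exists>k::nat. k > 0 \<and>
    image_mset (\<lambda>z. of_nat k * z) (O_eigenvalues X' S') \<subseteq># O_eigenvalues X S"
proof -
  interpret admissible_surjection X S X' S' \<phi>0 \<phi>1
    by unfold_locales (use assms in auto)
  \<comment> \<open>The witness \<open>k\<close> is \<open>fibre_size\<close>, which the
    intertwining relation puts in front of the target matrix; rescaling then moves it to the
    eigenvalues.\<close>
  have "eigenvalues_mset S' (\<lambda>a' b'. real fibre_size * O_entry X' S' a' b') \<subseteq># O_eigenvalues X S"
  proof (rule eigenvalues_mset_subset[where f = \<phi>1 and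
        w = "\<lambda>a. sqrt (valency X a / valency X' (\<phi>1 a))"])
    show "\<phi>1 ` S = S'" using surjective by (simp add: surjective_morphism_def)
  next
    fix a assume a: "a \<in> S"
    show "sqrt (valency X a / valency X' (\<phi>1 a)) \<noteq> 0"
      using dom.valency_pos[OF a] cod.valency_pos[OF relation_map[OF a]] by simp
  qed (use dom.finite_relations O_entry_intertwine in auto)
  thus ?thesis
    using fibre_size_pos eigenvalues_mset_scale[OF cod.finite_relations, of "real fibre_size" "O_entry X' S'"]
    by auto
qed

end
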